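(* Let $k\ge 1$ be an integer, let $\alpha_1,\beta_1,\dots,\alpha_k,\beta_k$ be complex parameters with $\alpha_j q^i\neq 1$ for all $i\ge 1$ and all $j$, and let $f(x_1,y_1,\dots,x_k,y_k)$ be a function of $2k$ complex variables that is analytic at $(0,0,\dots,0)\in\mathbb{C}^{2k}$. Then $f$ can be expanded as $$f(x_1,y_1,\dots,x_k,y_k)=\sum_{n_1,\dots,n_k=0}^{\infty}\lambda_{n_1,\dots,n_k}\,p_{n_1}^{(\alpha_1,\beta_1)}(x_1,y_1)\cdots p_{n_k}^{(\alpha_k,\beta_k)}(x_k,y_k),$$ where the coefficients $\lambda_{n_1,\dots,n_k}$ are independent of $x_1,y_1,\dots,x_k,y_k$, if and only if $f$ satisfies the $q$-partial differential equations $$\mathcal{D}_{q,x_j}(1-\alpha_j\eta_{x_j})\{f\}=-q\,\mathcal{D}_{q,y_j}\bigl(\eta_{y_j}^{-1}-q\alpha_j\beta_j\eta_{x_j}^2\bigr)\{f\}\qquad\text{for all } j\in\{1,2,\dots,k\}.$$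
   Context: Fix $q$ with $0<|q|<1$. $(a;q)_0=1$, $(a;q)_n=\prod_{i=0}^{n-1}(1-aq^i)$, and $\begin{bmatrix} n\\ k\end{bmatrix}=\frac{(q;q)_n}{(q;q)_k(q;q)_{n-k}}$. The homogeneous little $q$-Jacobi polynomials are, for $n\ge 0$, $$p_n^{(\alpha,\beta)}(x,y)=\sum_{k=0}^n q^{k(k+1-2n)/2}\begin{bmatrix} n\\ k\end{bmatrix}\frac{(\alpha\beta q^{n+1};q)_k}{(\alpha q;q)_k}(-x)^k y^{n-k}.$$ The $q$-partial derivative in a variable $x$ (other variables held constant) is $\mathcal{D}_{q,x}\{f\}=\frac{f(x)-f(qx)}{x}$ (extended to $x=0$ by continuity for analytic $f$). The $q$-shift operator $\eta_x^r$ replaces $x$ by $q^r x$. A product of operators is composition, e.g. $\mathcal{D}_{q,y}(\eta_y^{-1}-q\alpha\beta\eta_x^2)\{f\}=\mathcal{D}_{q,y}\{f(x,y/q)-q\alpha\beta f(q^2x,y)\}$. Expansions and equations are understood to hold in a neighbourhood of the origin, with the expansion converging absolutely there. *)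

theory Defs
  imports "HOL-Analysis.Analysis"
begin

text \<open>
  Complex \<open>m\<close>-space is \<^typ>\<open>complex ^ 'i\<close> with an index type of cardinality \<open>m\<close>.  Functions
  that are only relevant near the origin are total functions on this space; all statements about
  them are qualified by \<open>\<forall>\<^sub>F z in nhds 0\<close>.  Since \<open>has_sum\<close> is unordered summation,
  convergence of a complex series in this sense is the same as absolute convergence.
\<close>

definition analytic_at_point :: "(complex ^ 'i \<Rightarrow> complex) \<Rightarrow> complex ^ 'i \<Rightarrow> bool" where
  "analytic_at_point f w \<longleftrightarrow>
     (\<exists>a :: ('i \<Rightarrow> nat) \<Rightarrow> complex. \<forall>\<^sub>F z in nhds w.
        ((\<lambda>m. a m * (\<Prod>i\<in>UNIV. (z $ i - w $ i) ^ m i)) has_sum f z) UNIV)"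

definition qpoch :: "complex \<Rightarrow> complex \<Rightarrow> nat \<Rightarrow> complex" where
  "qpoch a q n = (\<Prod>i<n. 1 - a * q ^ i)"

definition qbinom :: "complex \<Rightarrow> nat \<Rightarrow> nat \<Rightarrow> complex" where
  "qbinom q n k = qpoch q q n / (qpoch q q k * qpoch q q (n - k))"

text \<open>
  The homogeneous little \<open>q\<close>-Jacobi polynomials.  The exponent of the leading power of \<open>q\<close> is in
  general a negative integer; the division by 2 is exact.
\<close>

definition little_qJacobi ::
    "complex \<Rightarrow> complex \<Rightarrow> complex \<Rightarrow> nat \<Rightarrow> complex \<Rightarrow> complex \<Rightarrow> complex" where
  "little_qJacobi q \<alpha> \<beta> n x y =
     (\<Sum>k\<le>n. q powi ((int k * (int k + 1 - 2 * int n)) div 2) * qbinom q n k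
        * (qpoch (\<alpha> * \<beta> * q ^ (n + 1)) q k / qpoch (\<alpha> * q) q k)
        * (- x) ^ k * y ^ (n - k))"

definition set_coord :: "complex ^ 'i \<Rightarrow> 'i \<Rightarrow> complex \<Rightarrow> complex ^ 'i" where
  "set_coord z i t = (\<chi> l. if l = i then t else z $ l)"

definition qshift ::
    "complex \<Rightarrow> 'i \<Rightarrow> int \<Rightarrow> (complex ^ 'i \<Rightarrow> complex) \<Rightarrow> complex ^ 'i \<Rightarrow> complex" where
  "qshift q i r f z = f (set_coord z i (q powi r * z $ i))"

text \<open>
  The \<open>q\<close>-partial derivative.  Where the \<open>i\<close>-th coordinate vanishes, it is the limit of the
  difference quotient as that coordinate tends to 0, the other coordinates being held fixed.
\<close>

definition qderiv ::
    "complex \<Rightarrow> 'i \<Rightarrow> (complex ^ 'i \<Rightarrow> complex) \<Rightarrow> complex ^ 'i \<Rightarrow> complex" where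
  "qderiv q i f z =
     (if z $ i \<noteq> 0 then (f z - f (set_coord z i (q * z $ i))) / z $ i
      else Lim (at 0) (\<lambda>t. (f (set_coord z i t) - f (set_coord z i (q * t))) / t))"

end

theory Submission
  imports Defs
begin

text \<open>
  Write \<open>f\<close> as a power series with coefficients \<open>a m\<close>.  Comparing coefficients, the \<open>j\<close>-th
  equation becomes a two-term recurrence which moves one unit of the exponent of \<open>y\<^sub>j\<close> to that of
  \<open>x\<^sub>j\<close>; it keeps the degree in each pair \<open>(x\<^sub>j, y\<^sub>j)\<close> fixed and is the recurrence of
  the coefficients of the \<open>q\<close>-Jacobi polynomials.  So all equations hold if and only if \<open>a m\<close>
  is a constant depending only on the pair degrees of \<open>m\<close>, times the coefficient of the product of
  polynomials.  Conversely, since that product is multihomogeneous, rescaling each pair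
  \<open>(x\<^sub>j, y\<^sub>j)\<close> by \<open>t\<^sub>j\<close> turns an expansion of \<open>f\<close> into a power series in \<open>t\<close>, whose
  coefficients must be the multihomogeneous components of \<open>f\<close>.
\<close>

section \<open>Power series and neighbourhoods of the origin\<close>

definition monomial :: "complex ^ 'i \<Rightarrow> ('i::finite \<Rightarrow> nat) \<Rightarrow> complex" where
  "monomial z m = (\<Prod>i\<in>UNIV. z $ i ^ m i)"

definition has_power_series ::
    "(complex ^ 'i \<Rightarrow> complex) \<Rightarrow> (('i::finite \<Rightarrow> nat) \<Rightarrow> complex) \<Rightarrow> bool" where
  "has_power_series f a \<longleftrightarrow> (\<forall>\<^sub>F z in nhds 0. ((\<lambda>m. a m * monomial z m) has_sum f z) UNIV)"

lemma analytic_at_point_0_iff: "analytic_at_point f 0 \<longleftrightarrow> (\<exists>a. has_power_series f a)"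
  by (simp add: analytic_at_point_def has_power_series_def monomial_def)

lemma set_coord_nth [simp]: "set_coord z i t $ l = (if l = i then t else z $ l)"
  by (simp add: set_coord_def)

lemma set_coord_set_coord [simp]: "set_coord (set_coord z i s) i t = set_coord z i t"
  by (simp add: vec_eq_iff)

lemma eventually_nhds_0_polydisc:
  fixes P :: "complex ^ 'i::finite \<Rightarrow> bool"
  shows "(\<forall>\<^sub>F z in nhds 0. P z) \<longleftrightarrow> (\<exists>r>0. \<forall>z. (\<forall>i. norm (z $ i) < r) \<longrightarrow> P z)"
proof
  assume "\<forall>\<^sub>F z in nhds 0. P z"
  then obtain d where d: "d > 0" "\<And>z. dist z 0 < d \<Longrightarrow> P z"
    by (auto simp: eventually_nhds_metric)
  define r where "r = d / real CARD('i)"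
  have "P z" if z: "\<forall>i. norm (z $ i) < r" for z
  proof -
    have "norm z \<le> (\<Sum>i\<in>UNIV. norm (z $ i))"
      by (simp add: norm_vec_def L2_set_le_sum)
    also have "\<dots> < (\<Sum>i\<in>(UNIV::'i set). r)"
      by (rule sum_strict_mono) (use z in auto)
    also have "\<dots> = d" by (simp add: r_def)
    finally show ?thesis using d(2) by simp
  qed
  moreover have "r > 0" using d(1) by (simp add: r_def)
  ultimately show "\<exists>r>0. \<forall>z. (\<forall>i. norm (z $ i) < r) \<longrightarrow> P z" by blast
next
  assume "\<exists>r>0. \<forall>z. (\<forall>i. norm (z $ i) < r) \<longrightarrow> P z"
  then obtain r where r: "r > 0" "\<And>z. (\<And>i. norm (z $ i) < r) \<Longrightarrow> P z" by blast
  have "P z" if "dist z 0 < r" for z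
    using that by (intro r(2)) (metis Finite_Cartesian_Product.norm_nth_le dist_0_norm dist_commute le_less_trans)
  then show "\<forall>\<^sub>F z in nhds 0. P z"
    unfolding eventually_nhds_metric using r(1) by blast
qed

text \<open>Serves both the \<open>q\<close>-shifts and the rescaling of pairs. \<open>C\<close> may
  exceed 1, as the shift by q^(-1) requires; only smallness of the arguments is used.\<close>

lemma eventually_nhds_0_comp_contraction:
  fixes P :: "complex ^ 'i::finite \<Rightarrow> bool" and \<phi> :: "complex ^ 'k::finite \<Rightarrow> complex ^ 'i"
  assumes "\<forall>\<^sub>F z in nhds 0. P z" and "\<And>z i. \<exists>k. norm (\<phi> z $ i) \<le> C * norm (z $ k)"
  shows "\<forall>\<^sub>F z in nhds 0. P (\<phi> z)"
proof -
  obtain r where r: "r > 0" "\<And>z. (\<And>i. norm (z $ i) < r) \<Longrightarrow> P z"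
    using assms(1) unfolding eventually_nhds_0_polydisc by blast
  \<comment> \<open>The denominator is positive whatever the sign of \<open>C\<close>.\<close>
  define s where "s = r / (1 + \<bar>C\<bar>)"
  have s: "s > 0" using r by (simp add: s_def)
  have "P (\<phi> z)" if z: "\<forall>k. norm (z $ k) < s" for z
  proof (rule r(2))
    fix i
    obtain k where k: "norm (\<phi> z $ i) \<le> C * norm (z $ k)" using assms(2) by blast
    also have "\<dots> \<le> (1 + \<bar>C\<bar>) * norm (z $ k)" by (intro mult_right_mono) auto
    also have "\<dots> < (1 + \<bar>C\<bar>) * s" using z by (intro mult_strict_left_mono) auto
    also have "\<dots> = r" by (simp add: s_def add_nonneg_eq_0_iff)
    finally show "norm (\<phi> z $ i) < r" .
  qed
  then show ?thesis unfolding eventually_nhds_0_polydisc using s by blast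
qed

section \<open>Regrouping of sums and uniqueness of power series coefficients\<close>

lemma has_sum_fibres:
  fixes f :: "'a \<Rightarrow> complex"
  assumes "(f has_sum s) A"
  shows "((\<lambda>k. \<Sum>\<^sub>\<infinity>m\<in>{m \<in> A. g m = k}. f m) has_sum s) UNIV"
proof (rule has_sum_Sigma')
  \<comment> \<open>Tagging each index with its value under \<open>g\<close> turns \<open>A\<close>
    into a disjoint union of fibres; \<open>snd\<close> removes the tag bijectively.\<close>
  show "((f \<circ> snd) has_sum s) (Sigma UNIV (\<lambda>k. {m \<in> A. g m = k}))"
  proof (subst has_sum_reindex[symmetric])
    show "inj_on snd (Sigma UNIV (\<lambda>k. {m \<in> A. g m = k}))" by (auto simp: inj_on_def)
    have "snd ` Sigma UNIV (\<lambda>k. {m \<in> A. g m = k}) = A" by force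
    then show "(f has_sum s) (snd ` Sigma UNIV (\<lambda>k. {m \<in> A. g m = k}))" using assms by simp
  qed
next
  fix k
  have "f summable_on {m \<in> A. g m = k}"
    by (rule summable_on_subset[OF has_sum_imp_summable[OF assms]]) auto
  then show "((\<lambda>y. (f \<circ> snd) (k, y)) has_sum (\<Sum>\<^sub>\<infinity>m\<in>{m \<in> A. g m = k}. f m)) {m \<in> A. g m = k}"
    by simp
qed

lemma has_sum_diff:
  fixes f g :: "'a \<Rightarrow> complex"
  assumes "(f has_sum s) A" "(g has_sum t) A"
  shows "((\<lambda>x. f x - g x) has_sum (s - t)) A"
  using has_sum_add[OF assms(1) has_sum_cmult_right[OF assms(2), of "-1"]] by simp

text \<open>The limit at 0 gives \<open>a 0 = 0\<close>; dividing by \<open>t\<close> shifts the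
  series, and the argument repeats. The hypothesis on a punctured disc is what survives this
  division.\<close>

lemma powser_eq_0_imp_coeff_eq_0:
  fixes a :: "nat \<Rightarrow> complex"
  assumes "r > 0" and "\<And>t. t \<noteq> 0 \<Longrightarrow> norm t < r \<Longrightarrow> (\<lambda>n. a n * t ^ n) sums 0"
  shows "a k = 0"
  using assms(2)
proof (induction k arbitrary: a)
  case 0
  have "((\<lambda>_. 0) \<longlongrightarrow> a 0) (at (0 :: complex))"
    by (rule powser_limit_0_strong[OF assms(1)]) (use 0 in auto)
  then show ?case by (simp add: tendsto_const_iff)
next
  case (Suc k)
  have a0: "a 0 = 0"
  proof -
    have "((\<lambda>_. 0) \<longlongrightarrow> a 0) (at (0 :: complex))"
      by (rule powser_limit_0_strong[OF assms(1)]) (use Suc.prems in auto)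
    then show ?thesis by (simp add: tendsto_const_iff)
  qed
  show ?case
  proof (rule Suc.IH)
    fix t :: complex assume t: "t \<noteq> 0" "norm t < r"
    have "(\<lambda>n. a (Suc n) * t ^ Suc n) sums 0"
      using Suc.prems[OF t] a0 by (subst sums_Suc_iff) simp
    from sums_mult[OF this, of "inverse t"] t show "(\<lambda>n. a (Suc n) * t ^ n) sums 0"
      by (simp add: field_simps)
  qed
qed

text \<open>Reduction to one variable: the coordinates are treated one after another, each time
  extracting the part of the series with the prescribed exponent.\<close>

lemma has_power_series_0_imp_coeff_eq_0:
  fixes b :: "('i::finite \<Rightarrow> nat) \<Rightarrow> complex"
  assumes "has_power_series (\<lambda>_. 0) b"
  shows "b m\<^sub>0 = 0"
proof -
  \<comment> \<open>For coordinates in \<open>S\<close> the exponent is already frozen at that of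
    \<open>m\<^sub>0\<close> and the variable is gone from the monomial.\<close>
  have "\<forall>\<^sub>F z in nhds (0 :: complex ^ 'i).
          ((\<lambda>m. b m * (\<Prod>i\<in>-S. z $ i ^ m i)) has_sum 0) {m. \<forall>i\<in>S. m i = m\<^sub>0 i}" for S
  proof (induction S rule: finite_induct[OF finite])
    case 1
    then show ?case using assms by (simp add: has_power_series_def monomial_def)
  next
    case (2 x S)
    define A where "A = {m. \<forall>i\<in>S. m i = m\<^sub>0 i}"
    define R where "R z m = b m * (\<Prod>i\<in>-insert x S. z $ i ^ m i)" for z :: "complex ^ 'i" and m
    obtain r where r: "r > 0" and sum: "\<And>z :: complex ^ 'i. (\<And>i. norm (z $ i) < r) \<Longrightarrow>
          ((\<lambda>m. b m * (\<Prod>i\<in>-S. z $ i ^ m i)) has_sum 0) A"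
      using "2.IH" unfolding eventually_nhds_0_polydisc A_def by blast
    have "(R z has_sum 0) {m. \<forall>i\<in>insert x S. m i = m\<^sub>0 i}" if z: "\<forall>i. norm (z $ i) < r" for z
    proof -
      \<comment> \<open>Letting only coordinate \<open>x\<close> vary as \<open>t\<close> isolates
        the factor \<open>t ^ m x\<close>; grouping by \<open>m x\<close> then gives a power series
        in \<open>t\<close> with sum 0.\<close>
      have split: "((\<lambda>m. t ^ m x * R z m) has_sum 0) A" if "norm t < r" for t
      proof -
        have "b m * (\<Prod>i\<in>-S. set_coord z x t $ i ^ m i) = t ^ m x * R z m" for m
        proof -
          have "-S = insert x (-insert x S)" using 2 by auto
          then have "(\<Prod>i\<in>-S. set_coord z x t $ i ^ m i)
              = t ^ m x * (\<Prod>i\<in>-insert x S. set_coord z x t $ i ^ m i)"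
            by (metis (no_types, lifting) ComplD finite insertI1 prod.insert set_coord_nth)
          also have "(\<Prod>i\<in>-insert x S. set_coord z x t $ i ^ m i) = (\<Prod>i\<in>-insert x S. z $ i ^ m i)"
            by (rule prod.cong) auto
          finally show ?thesis by (simp add: R_def)
        qed
        then show ?thesis using sum[of "set_coord z x t"] z that by simp
      qed
      define E where "E k = (\<Sum>\<^sub>\<infinity>m\<in>{m \<in> A. m x = k}. R z m)" for k
      have "E (m\<^sub>0 x) = 0"
      proof (rule powser_eq_0_imp_coeff_eq_0[OF r])
        fix t :: complex assume "norm t < r"
        from has_sum_fibres[OF split[OF this], of "\<lambda>m. m x"]
        have "((\<lambda>k. \<Sum>\<^sub>\<infinity>m\<in>{m \<in> A. m x = k}. t ^ k * R z m) has_sum 0) UNIV"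
          by (rule has_sum_cong[THEN iffD1, rotated]) (auto intro!: infsum_cong)
        then show "(\<lambda>k. E k * t ^ k) sums 0"
          by (intro has_sum_imp_sums) (simp add: infsum_cmult_right' E_def mult.commute)
      qed
      \<comment> \<open>\<open>infsum\<close> is 0 by default on a non-summable family, so
        \<open>E (m\<^sub>0 x) = 0\<close> alone does not give \<open>has_sum\<close>. On this fibre
        the power of \<open>t\<close> is constant and can be divided out at a nonzero
        \<open>t\<close>.\<close>
      moreover have summable: "R z summable_on {m \<in> A. m x = m\<^sub>0 x}"
      proof -
        define t where "t = complex_of_real (r / 2)"
        have t: "t \<noteq> 0" "norm t < r" using r by (auto simp: t_def norm_divide)
        have "(\<lambda>m. t ^ m x * R z m) summable_on {m \<in> A. m x = m\<^sub>0 x}"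
          by (rule summable_on_subset[OF has_sum_imp_summable[OF split[OF t(2)]]]) auto
        then have "(\<lambda>m. t ^ m\<^sub>0 x * R z m) summable_on {m \<in> A. m x = m\<^sub>0 x}"
          by (rule summable_on_cong[THEN iffD1, rotated]) auto
        then show ?thesis using t by (simp add: summable_on_cmult_right')
      qed
      moreover have "{m \<in> A. m x = m\<^sub>0 x} = {m. \<forall>i\<in>insert x S. m i = m\<^sub>0 i}"
        by (auto simp: A_def)
      ultimately show ?thesis using has_sum_infsum[OF summable] by (simp only: E_def)
    qed
    then show ?case unfolding eventually_nhds_0_polydisc R_def using r by blast
  qed
  \<comment> \<open>With all exponents frozen, the index set is a singleton and the product is
    empty.\<close>
  from this[of UNIV] have "\<forall>\<^sub>F z in nhds (0 :: complex ^ 'i). (b has_sum 0) {m\<^sub>0}"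
    by (simp add: fun_eq_iff[symmetric])
  then have "(b has_sum 0) {m\<^sub>0}" by (simp add: eventually_const_iff)
  then show ?thesis using has_sum_unique[OF _ has_sum_finite[of "{m\<^sub>0}" b]] by fastforce
qed

lemma has_power_series_diff:
  assumes "has_power_series f a" "has_power_series g b"
  shows "has_power_series (\<lambda>z. f z - g z) (\<lambda>m. a m - b m)"
  using assms unfolding has_power_series_def
  by eventually_elim (simp add: left_diff_distrib has_sum_diff)

lemma has_power_series_cmult:
  assumes "has_power_series f a"
  shows "has_power_series (\<lambda>z. c * f z) (\<lambda>m. c * a m)"
  using assms unfolding has_power_series_def
  by eventually_elim (simp add: mult.assoc has_sum_cmult_right)

text \<open>The bridge from functional equations near the origin to identities between
  coefficients.\<close>

lemma has_power_series_eventually_eq_iff: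
  assumes f: "has_power_series f a" and g: "has_power_series g b"
  shows "(\<forall>\<^sub>F z in nhds 0. f z = g z) \<longleftrightarrow> (\<forall>m. a m = b m)"
proof
  assume "\<forall>\<^sub>F z in nhds 0. f z = g z"
  with has_power_series_diff[OF f g] have "has_power_series (\<lambda>_. 0) (\<lambda>m. a m - b m)"
    unfolding has_power_series_def by (rule eventually_elim2) simp
  from has_power_series_0_imp_coeff_eq_0[OF this] show "\<forall>m. a m = b m" by simp
next
  assume "\<forall>m. a m = b m"
  then have "a = b" by auto
  with g have "has_power_series g a" by simp
  with f show "\<forall>\<^sub>F z in nhds 0. f z = g z"
    unfolding has_power_series_def by (rule eventually_elim2) (rule has_sum_unique)
qed

section \<open>The action of \<open>q\<close>-shifts and \<open>q\<close>-derivatives on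
  coefficients\<close>

lemma monomial_set_coord_scale:
  "monomial (set_coord z i (c * z $ i)) m = c ^ m i * monomial z m"
proof -
  have "monomial (set_coord z i (c * z $ i)) m
      = (\<Prod>l\<in>UNIV. (if l = i then c ^ m i else 1) * z $ l ^ m l)"
    unfolding monomial_def by (rule prod.cong) (auto simp: power_mult_distrib)
  then show ?thesis by (simp add: prod.distrib monomial_def)
qed

lemma monomial_set_coord:
  "monomial (set_coord z i t) m = t ^ m i * (\<Prod>l\<in>-{i}. z $ l ^ m l)"
proof -
  have "monomial (set_coord z i t) m = t ^ m i * (\<Prod>l\<in>UNIV-{i}. set_coord z i t $ l ^ m l)"
    unfolding monomial_def by (subst prod.remove[of UNIV i]) auto
  also have "(\<Prod>l\<in>UNIV-{i}. set_coord z i t $ l ^ m l) = (\<Prod>l\<in>-{i}. z $ l ^ m l)"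
    by (rule prod.cong) auto
  finally show ?thesis .
qed

lemma monomial_fun_upd_Suc: "monomial z (m(i := Suc (m i))) = z $ i * monomial z m"
proof -
  have "monomial z (m(i := Suc (m i))) = (\<Prod>l\<in>UNIV. (if l = i then z $ i else 1) * z $ l ^ m l)"
    unfolding monomial_def by (rule prod.cong) auto
  then show ?thesis by (simp add: prod.distrib monomial_def)
qed

lemma has_power_series_qshift:
  assumes "has_power_series f a"
  shows "has_power_series (qshift q i r f) (\<lambda>m. (q powi r) ^ m i * a m)"
proof -
  have "\<forall>\<^sub>F z in nhds 0. ((\<lambda>m. a m * monomial (set_coord z i (q powi r * z $ i)) m) has_sum
          f (set_coord z i (q powi r * z $ i))) UNIV"
  \<comment> \<open>The summand 1 covers the unchanged coordinates, the norm covers the scaled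
    one.\<close>
  proof (rule eventually_nhds_0_comp_contraction[OF assms[unfolded has_power_series_def],
           where C = "1 + norm (q powi r)"])
    fix z :: "complex ^ 'a" and l
    show "\<exists>k. norm (set_coord z i (q powi r * z $ i) $ l) \<le> (1 + norm (q powi r)) * norm (z $ k)"
      by (rule exI[of _ l]) (auto simp: norm_mult distrib_right)
  qed
  then show ?thesis
    unfolding has_power_series_def
    by eventually_elim (simp add: qshift_def monomial_set_coord_scale mult.left_commute mult.assoc)
qed

text \<open>The difference quotient acts termwise, sending z_i^n to (1 - q^n) z_i^(n-1). The bound
  on \<open>q\<close> keeps the shifted point in the polydisc; points with z_i = 0 need a
  limit.\<close>

lemma has_power_series_qderiv:
  fixes g :: "complex ^ 'i::finite \<Rightarrow> complex"
  assumes g: "has_power_series g b" and q: "norm q < 1"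
  shows "has_power_series (qderiv q i g) (\<lambda>m. (1 - q ^ Suc (m i)) * b (m(i := Suc (m i))))"
proof -
  define d where "d m = (1 - q ^ Suc (m i)) * b (m(i := Suc (m i)))" for m
  obtain r where r: "r > 0" and sum: "\<And>z :: complex ^ 'i. (\<And>l. norm (z $ l) < r) \<Longrightarrow>
        ((\<lambda>m. b m * monomial z m) has_sum g z) UNIV"
    using g unfolding has_power_series_def eventually_nhds_0_polydisc by blast
  have quot: "((\<lambda>m. d m * monomial w m) has_sum ((g w - g (set_coord w i (q * w $ i))) / w $ i)) UNIV"
    if w: "\<And>l. norm (w $ l) < r" and wi: "w $ i \<noteq> 0" for w :: "complex ^ 'i"
  proof -
    have "norm (q * w $ i) < r"
    proof -
      have "norm (q * w $ i) \<le> 1 * norm (w $ i)"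
        unfolding norm_mult using q by (intro mult_right_mono) auto
      then show ?thesis using w[of i] by simp
    qed
    then have "((\<lambda>m. b m * monomial (set_coord w i (q * w $ i)) m) has_sum
          g (set_coord w i (q * w $ i))) UNIV"
      using w by (intro sum) auto
    from has_sum_diff[OF sum[OF w] this]
    have *: "((\<lambda>m. (1 - q ^ m i) * b m * monomial w m) has_sum
          (g w - g (set_coord w i (q * w $ i)))) UNIV"
      by (simp add: monomial_set_coord_scale algebra_simps)
    \<comment> \<open>Terms outside the range of \<open>h\<close> have exponent 0 in coordinate
      \<open>i\<close> and vanish because 1 - q^0 = 0; so the sum can be reindexed along
      \<open>h\<close>, and one factor \<open>w $ i\<close> cancels.\<close>
    define h where "h m = m(i := Suc (m i))" for m :: "'i \<Rightarrow> nat"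
    have inj: "inj h"
    proof (rule injI)
      fix m m' assume "h m = h m'"
      then have "h m l = h m' l" for l by simp
      then have "m l = m' l" for l
        by (cases "l = i") (auto simp: h_def dest!: meta_spec[of _ l])
      then show "m = m'" by auto
    qed
    have zero: "(1 - q ^ m i) * b m * monomial w m = 0" if "m \<notin> range h" for m
    proof (cases "m i")
      case (Suc n)
      then have "m = h (m(i := n))" by (auto simp: h_def fun_eq_iff)
      with that show ?thesis by blast
    qed simp
    have "((\<lambda>m. (1 - q ^ m i) * b m * monomial w m) has_sum
          (g w - g (set_coord w i (q * w $ i)))) (range h)"
      by (rule has_sum_cong_neutral[THEN iffD1, OF _ _ _ *]) (use zero in auto)
    then have "((\<lambda>m. (1 - q ^ h m i) * b (h m) * monomial w (h m)) has_sum
          (g w - g (set_coord w i (q * w $ i)))) UNIV"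
      by (simp add: has_sum_reindex[OF inj] o_def)
    from has_sum_cmult_right[OF this, of "inverse (w $ i)"]
    have "((\<lambda>m. inverse (w $ i) * ((1 - q ^ h m i) * b (h m) * monomial w (h m))) has_sum
          ((g w - g (set_coord w i (q * w $ i))) / w $ i)) UNIV"
      by (simp only: divide_inverse mult.commute)
    moreover have "inverse (w $ i) * ((1 - q ^ h m i) * b (h m) * monomial w (h m)) = d m * monomial w m" for m
    proof -
      have "inverse (w $ i) * ((1 - q ^ h m i) * b (h m) * monomial w (h m))
          = (inverse (w $ i) * w $ i) * ((1 - q ^ Suc (m i)) * b (m(i := Suc (m i))) * monomial w m)"
        unfolding h_def monomial_fun_upd_Suc by (simp only: fun_upd_same mult_ac)
      then show ?thesis using wi by (simp only: left_inverse mult_1 d_def not_False_eq_True)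
    qed
    ultimately show ?thesis by simp
  qed
  have "((\<lambda>m. d m * monomial z m) has_sum qderiv q i g z) UNIV" if z: "\<forall>l. norm (z $ l) < r" for z
  proof (cases "z $ i = 0")
    case False
    then show ?thesis using quot[of z] z by (simp add: qderiv_def)
  next
    case True
    define R where "R m = d m * (\<Prod>l\<in>-{i}. z $ l ^ m l)" for m
    \<comment> \<open>Along the line through \<open>z\<close> in direction \<open>i\<close>, the
      quotient is a power series in \<open>t\<close>, and its limit at 0 is the constant coefficient
      \<open>E 0\<close>.\<close>
    define Q where "Q t = (g (set_coord z i t) - g (set_coord z i (q * t))) / t" for t
    have split: "((\<lambda>m. t ^ m i * R m) has_sum Q t) UNIV" if "t \<noteq> 0" "norm t < r" for t
      using quot[of "set_coord z i t"] that z
      by (simp add: monomial_set_coord R_def Q_def mult_ac)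
    define E where "E k = (\<Sum>\<^sub>\<infinity>m\<in>{m. m i = k}. R m)" for k
    have "(Q \<longlongrightarrow> E 0) (at 0)"
    proof (rule powser_limit_0_strong[OF r])
      fix t :: complex assume t: "t \<noteq> 0" "norm t < r"
      from has_sum_fibres[OF split[OF t], of "\<lambda>m. m i"]
      have "((\<lambda>k. \<Sum>\<^sub>\<infinity>m\<in>{m. m i = k}. t ^ k * R m) has_sum Q t) UNIV"
        by (rule has_sum_cong[THEN iffD1, rotated]) (auto intro!: infsum_cong)
      then have "((\<lambda>k. t ^ k * E k) has_sum Q t) UNIV"
        by (simp only: infsum_cmult_right' E_def)
      then show "(\<lambda>k. E k * t ^ k) sums Q t"
        by (intro has_sum_imp_sums) (simp only: mult.commute)
    qed
    then have "Lim (at 0) Q = E 0" by (intro tendsto_Lim) auto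
    moreover have "qderiv q i g z = Lim (at 0) Q"
      unfolding qderiv_def Q_def using True by simp
    \<comment> \<open>Excludes the default value of \<open>infsum\<close> in \<open>E 0\<close>: on
      this fibre \<open>t ^ m i = 1\<close>, so summability at one nonzero \<open>t\<close> carries
      over.\<close>
    moreover have "R summable_on {m. m i = 0}"
    proof -
      define t where "t = complex_of_real (r / 2)"
      have t: "t \<noteq> 0" "norm t < r" using r by (auto simp: t_def norm_divide)
      have "(\<lambda>m. t ^ m i * R m) summable_on {m. m i = 0}"
        by (rule summable_on_subset[OF has_sum_imp_summable[OF split[OF t]]]) simp
      moreover have "(\<lambda>m. t ^ m i * R m) summable_on {m. m i = 0} \<longleftrightarrow> ?thesis"
        by (rule summable_on_cong) simp
      ultimately show ?thesis by simp
    qed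
    ultimately have *: "(R has_sum qderiv q i g z) {m. m i = 0}"
      by (simp add: E_def)
    \<comment> \<open>Since z_i = 0, all terms with \<open>m i > 0\<close> vanish, so the sum over
      the fibre is the full sum.\<close>
    have "set_coord z i 0 = z" using True by (simp add: vec_eq_iff)
    then have "monomial z m = 0 ^ m i * (\<Prod>l\<in>-{i}. z $ l ^ m l)" for m
      using monomial_set_coord[of z i 0 m] by simp
    then show ?thesis
      by (intro has_sum_cong_neutral[THEN iffD1, OF _ _ _ *]) (simp_all add: R_def)
  qed
  then show ?thesis
    unfolding has_power_series_def eventually_nhds_0_polydisc d_def using r by blast
qed

section \<open>Multihomogeneous components; \<open>Inl j\<close> and \<open>Inr j\<close> index x_j
  and y_j\<close>

definition pair_degree :: "('k + 'k \<Rightarrow> nat) \<Rightarrow> 'k \<Rightarrow> nat" where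
  "pair_degree m j = m (Inl j) + m (Inr j)"

lemma monomial_sum_index:
  "monomial z m = (\<Prod>j\<in>UNIV. z $ Inl j ^ m (Inl j) * z $ Inr j ^ m (Inr j))"
  for m :: "'k::finite + 'k \<Rightarrow> nat"
  unfolding monomial_def UNIV_Plus_UNIV[symmetric]
  by (subst prod.Plus) (simp_all add: prod.distrib)

text \<open>Given the pair degrees, the exponents of the x_j determine those of the y_j. So the
  fibre is finite and is indexed by choice functions, as needed to expand a product of sums.\<close>

lemma pair_degree_eq_iff:
  "pair_degree m = n \<longleftrightarrow>
     m \<in> (\<lambda>\<kappa>. case_sum \<kappa> (\<lambda>j. n j - \<kappa> j)) ` (\<Pi>\<^sub>E j\<in>UNIV. {..n j})"
proof
  assume n: "pair_degree m = n"
  have "m = case_sum (\<lambda>j. m (Inl j)) (\<lambda>j. n j - m (Inl j))"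
    unfolding n[symmetric] by (auto simp: fun_eq_iff pair_degree_def split: sum.split)
  moreover have "(\<lambda>j. m (Inl j)) \<in> (\<Pi>\<^sub>E j\<in>UNIV. {..n j})"
    unfolding n[symmetric] by (auto simp: pair_degree_def)
  ultimately show "m \<in> (\<lambda>\<kappa>. case_sum \<kappa> (\<lambda>j. n j - \<kappa> j)) ` (\<Pi>\<^sub>E j\<in>UNIV. {..n j})"
    by (rule image_eqI)
next
  assume "m \<in> (\<lambda>\<kappa>. case_sum \<kappa> (\<lambda>j. n j - \<kappa> j)) ` (\<Pi>\<^sub>E j\<in>UNIV. {..n j})"
  then obtain \<kappa> where m: "m = case_sum \<kappa> (\<lambda>j. n j - \<kappa> j)" and \<kappa>: "\<And>j. \<kappa> j \<le> n j"
    by (auto simp: PiE_iff)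
  show "pair_degree m = n"
    using \<kappa> by (auto simp: pair_degree_def m)
qed

lemma finite_pair_degree_fibre: "finite {m :: 'k::finite + 'k \<Rightarrow> nat. pair_degree m = n}"
  unfolding pair_degree_eq_iff by (simp add: finite_PiE)

lemma sum_pair_degree_fibre:
  fixes h :: "'k::finite \<Rightarrow> nat \<Rightarrow> nat \<Rightarrow> complex"
  shows "(\<Sum>m | pair_degree m = n. \<Prod>j\<in>UNIV. h j (m (Inl j)) (m (Inr j)))
       = (\<Prod>j\<in>UNIV. \<Sum>k\<le>n j. h j k (n j - k))"
proof -
  let ?e = "\<lambda>\<kappa>. case_sum \<kappa> (\<lambda>j. n j - \<kappa> j)"
  have "inj ?e"
    by (rule injI) (auto simp: fun_eq_iff split: sum.splits dest: spec[of _ "Inl _"])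
  then have inj: "inj_on ?e (\<Pi>\<^sub>E j\<in>UNIV. {..n j})" by (rule inj_on_subset) simp
  show ?thesis
    unfolding pair_degree_eq_iff Collect_mem_eq
    by (subst sum.reindex[OF inj]) (simp add: prod_sum_PiE)
qed

lemma has_power_series_imp_has_sum_homogeneous:
  fixes f :: "complex ^ ('k::finite + 'k) \<Rightarrow> complex"
  assumes "has_power_series f a"
  shows "\<forall>\<^sub>F z in nhds 0.
           ((\<lambda>n. \<Sum>m | pair_degree m = n. a m * monomial z m) has_sum f z) UNIV"
  using assms unfolding has_power_series_def
proof eventually_elim
  case (elim z)
  from has_sum_fibres[OF this, of pair_degree] show ?case
    by (simp add: finite_pair_degree_fibre)
qed

text \<open>The expansion is summed over pair degrees only, so it is not a power series in
  \<open>z\<close> whose coefficients could be compared at once. For fixed \<open>z\<close>,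
  rescaling the pairs makes its terms the coefficients of a power series in the scaling
  parameters.\<close>

lemma has_sum_homogeneous_iff:
  fixes f :: "complex ^ ('k::finite + 'k) \<Rightarrow> complex"
  assumes f: "has_power_series f a"
  shows "(\<forall>\<^sub>F z in nhds 0.
            ((\<lambda>n. c n * (\<Sum>m | pair_degree m = n. b m * monomial z m)) has_sum f z) UNIV)
         \<longleftrightarrow> (\<forall>m. a m = c (pair_degree m) * b m)"
    (is "?expansion \<longleftrightarrow> ?coeffs")
proof
  assume ?coeffs
  then have "(\<Sum>m | pair_degree m = n. a m * monomial z m)
      = c n * (\<Sum>m | pair_degree m = n. b m * monomial z m)" for n z
    unfolding sum_distrib_left by (intro sum.cong) auto
  then show ?expansion using has_power_series_imp_has_sum_homogeneous[OF f] by simp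
next
  assume exp: ?expansion
  define H where "H a n z = (\<Sum>m | pair_degree m = n. a m * monomial z m)"
    for a :: "('k + 'k \<Rightarrow> nat) \<Rightarrow> complex" and n and z :: "complex ^ ('k + 'k)"
  have homogeneous_eq: "H a n z = c n * H b n z" for n z
  proof -
    \<comment> \<open>Both members of the \<open>j\<close>-th pair are multiplied by
      \<open>t $ j\<close>; \<open>case_sum id id\<close> reads off the pair to which a coordinate
      belongs.\<close>
    define \<phi> :: "complex ^ 'k \<Rightarrow> complex ^ ('k + 'k)"
      where "\<phi> t = (\<chi> i. t $ (case_sum id id i) * z $ i)" for t
    have \<phi>: "H d n (\<phi> t) = H d n z * monomial t n" for d n t
    proof -
      have "monomial (\<phi> t) m = monomial z m * monomial t (pair_degree m)" for m
        unfolding monomial_sum_index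
        by (simp add: monomial_def prod.distrib[symmetric] \<phi>_def pair_degree_def
              power_mult_distrib power_add mult_ac)
      then show ?thesis
        unfolding H_def sum_distrib_right by (intro sum.cong) (auto simp: mult.assoc)
    qed
    \<comment> \<open>Here \<open>z\<close> is fixed and need not be small, so its norm serves as
      the constant; only \<open>t\<close> tends to 0.\<close>
    have contraction: "\<exists>k. norm (\<phi> t $ i) \<le> norm z * norm (t $ k)" for t i
      by (rule exI[of _ "case_sum id id i"])
         (simp add: \<phi>_def norm_mult mult.commute mult_right_mono Finite_Cartesian_Product.norm_nth_le)
    have "has_power_series (\<lambda>t. f (\<phi> t)) (\<lambda>n. H a n z)"
      using eventually_nhds_0_comp_contraction
        [OF has_power_series_imp_has_sum_homogeneous[OF f, folded H_def] contraction]
      by (simp add: has_power_series_def \<phi>)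
    moreover have "has_power_series (\<lambda>t. f (\<phi> t)) (\<lambda>n. c n * H b n z)"
      using eventually_nhds_0_comp_contraction[OF exp[folded H_def] contraction]
      by (simp add: has_power_series_def \<phi> mult.assoc)
    ultimately show ?thesis
      using has_power_series_eventually_eq_iff by fastforce
  qed
  show ?coeffs
  proof
    fix m\<^sub>0 :: "'k + 'k \<Rightarrow> nat"
    \<comment> \<open>Each component is a polynomial in \<open>z\<close>, hence a power series with
      finite support, so equal components have equal coefficients.\<close>
    have H: "has_power_series (H d n) (\<lambda>m. if pair_degree m = n then d m else 0)" for d n
      unfolding has_power_series_def H_def
      by (intro always_eventually allI has_sum_finite_neutralI[OF finite_pair_degree_fibre[of n]]) auto
    have "\<forall>\<^sub>F z in nhds 0. H a (pair_degree m\<^sub>0) z = c (pair_degree m\<^sub>0) * H b (pair_degree m\<^sub>0) z"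
      by (simp add: homogeneous_eq)
    from this[unfolded has_power_series_eventually_eq_iff[OF H has_power_series_cmult[OF H]], rule_format, of m\<^sub>0]
    show "a m\<^sub>0 = c (pair_degree m\<^sub>0) * b m\<^sub>0" by simp
  qed
qed

section \<open>Coefficients of the little \<open>q\<close>-Jacobi polynomials\<close>

definition jacobi_coeff :: "complex \<Rightarrow> complex \<Rightarrow> complex \<Rightarrow> nat \<Rightarrow> nat \<Rightarrow> complex" where
  "jacobi_coeff q \<alpha> \<beta> n k =
     q powi ((int k * (int k + 1 - 2 * int n)) div 2) * qbinom q n k
       * (qpoch (\<alpha> * \<beta> * q ^ (n + 1)) q k / qpoch (\<alpha> * q) q k) * (- 1) ^ k"

lemma little_qJacobi_eq:
  "little_qJacobi q \<alpha> \<beta> n x y = (\<Sum>k\<le>n. jacobi_coeff q \<alpha> \<beta> n k * (x ^ k * y ^ (n - k)))"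
  unfolding little_qJacobi_def jacobi_coeff_def power_minus[of x] by (simp only: mult.assoc)

lemma qpoch_0 [simp]: "qpoch a q 0 = 1"
  by (simp add: qpoch_def)

lemma qpoch_Suc: "qpoch a q (Suc n) = qpoch a q n * (1 - a * q ^ n)"
  by (simp add: qpoch_def)

lemma power_Suc_neq_1:
  fixes q :: complex
  assumes "norm q < 1"
  shows "q ^ Suc n \<noteq> 1"
proof
  assume "q ^ Suc n = 1"
  then have "norm q ^ Suc n = 1" by (metis norm_one norm_power)
  then show False using assms power_less_one_iff[of "norm q" "Suc n"] by simp
qed

lemma qpoch_q_q_neq_0:
  assumes "norm q < 1"
  shows "qpoch q q n \<noteq> 0"
  using power_Suc_neq_1[OF assms] by (auto simp: qpoch_def)

lemma jacobi_coeff_0 [simp]: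
  assumes "norm q < 1"
  shows "jacobi_coeff q \<alpha> \<beta> n 0 = 1"
  using qpoch_q_q_neq_0[OF assms] by (simp add: jacobi_coeff_def qbinom_def)

text \<open>In the ratio of consecutive coefficients, the power of \<open>q\<close>, the
  \<open>q\<close>-binomial and the quotient of \<open>q\<close>-Pochhammer symbols each contribute
  an elementary factor. These are arranged as in the coefficient comparison for the equation, with
  \<open>k\<close> and \<open>l\<close> the exponents of x and y.\<close>

lemma jacobi_coeff_Suc:
  assumes q: "q \<noteq> 0" "norm q < 1" and \<alpha>: "\<And>i. i \<ge> 1 \<Longrightarrow> \<alpha> * q ^ i \<noteq> 1"
    and n: "n = Suc (k + l)"
  shows "(1 - q ^ Suc k) * ((1 - \<alpha> * q ^ Suc k) * jacobi_coeff q \<alpha> \<beta> n (Suc k))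
       = - q * ((1 - q ^ Suc l) * (((q powi (- 1)) ^ Suc l - q * \<alpha> * \<beta> * (q powi 2) ^ k)
           * jacobi_coeff q \<alpha> \<beta> n k))"
proof -
  \<comment> \<open>The two numerators differ by the even number -2l, so the integer division
    commutes with the difference.\<close>
  have "int (Suc k) * (int (Suc k) + 1 - 2 * int n) = int k * (int k + 1 - 2 * int n) + - int l * 2"
    by (simp add: n algebra_simps)
  then have "int (Suc k) * (int (Suc k) + 1 - 2 * int n) div 2
      = int k * (int k + 1 - 2 * int n) div 2 + - int l"
    by simp
  then have E: "q powi (int (Suc k) * (int (Suc k) + 1 - 2 * int n) div 2)
      = q powi (int k * (int k + 1 - 2 * int n) div 2) * inverse (q ^ l)"
    using q by (simp only: power_int_add power_int_minus power_int_of_nat simp_thms)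
  have q1: "1 - q ^ Suc i \<noteq> 0" for i using power_Suc_neq_1[OF q(2)] by (metis eq_iff_diff_eq_0)
  have \<alpha>1: "1 - \<alpha> * q ^ Suc i \<noteq> 0" for i using \<alpha>[of "Suc i"] by simp
  have "n - k = Suc l" "n - Suc k = l" by (auto simp: n)
  then have B: "(1 - q ^ Suc k) * qbinom q n (Suc k) = (1 - q ^ Suc l) * qbinom q n k"
    using q1[of k] q1[of l] qpoch_q_q_neq_0[OF q(2)] unfolding qbinom_def
    by (simp add: qpoch_Suc)
  define A where "A = qpoch (\<alpha> * \<beta> * q ^ (n + 1)) q k / qpoch (\<alpha> * q) q k"
  have A: "(1 - \<alpha> * q ^ Suc k) * (qpoch (\<alpha> * \<beta> * q ^ (n + 1)) q (Suc k) / qpoch (\<alpha> * q) q (Suc k))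
      = (1 - \<alpha> * \<beta> * q ^ (n + 1) * q ^ k) * A"
    using \<alpha>1[of k] by (simp add: qpoch_Suc A_def mult.assoc)
  \<comment> \<open>Since n + 1 + k = l + 2 + 2k, the factor q^(-l) from the leading power and the
    new Pochhammer factor combine into the shift factor of the equation.\<close>
  have q2: "inverse (q ^ l) * (1 - \<alpha> * \<beta> * q ^ (n + 1) * q ^ k)
      = q * ((q powi (- 1)) ^ Suc l - q * \<alpha> * \<beta> * (q powi 2) ^ k)"
  proof -
    have "(q powi 2) ^ k = q ^ k * q ^ k"
      by (simp add: power2_eq_square power_mult_distrib)
    moreover have "q ^ (n + 1) * q ^ k = q ^ l * (q * q * (q ^ k * q ^ k))"
      by (simp add: n power_add mult_ac)
    ultimately show ?thesis
      using q(1) by (simp add: power_int_minus field_simps)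
  qed
  have "(1 - q ^ Suc k) * ((1 - \<alpha> * q ^ Suc k) * jacobi_coeff q \<alpha> \<beta> n (Suc k))
      = q powi (int k * (int k + 1 - 2 * int n) div 2) * inverse (q ^ l)
        * ((1 - q ^ Suc k) * qbinom q n (Suc k))
        * ((1 - \<alpha> * q ^ Suc k) * (qpoch (\<alpha> * \<beta> * q ^ (n + 1)) q (Suc k) / qpoch (\<alpha> * q) q (Suc k)))
        * (- 1) ^ Suc k"
    unfolding jacobi_coeff_def E by (simp only: mult_ac)
  also have "\<dots> = - ((1 - q ^ Suc l) * (inverse (q ^ l) * (1 - \<alpha> * \<beta> * q ^ (n + 1) * q ^ k))
        * jacobi_coeff q \<alpha> \<beta> n k)"
    unfolding A B jacobi_coeff_def A_def[symmetric] power_Suc[of "- 1"]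
    by (simp only: mult_minus_left mult_minus_right mult_1 mult_ac)
  finally show ?thesis unfolding q2 by (simp add: mult_ac)
qed

definition jacobi_multicoeff ::
    "complex \<Rightarrow> ('k::finite \<Rightarrow> complex) \<Rightarrow> ('k \<Rightarrow> complex) \<Rightarrow> ('k + 'k \<Rightarrow> nat) \<Rightarrow> complex" where
  "jacobi_multicoeff q \<alpha> \<beta> m =
     (\<Prod>j\<in>UNIV. jacobi_coeff q (\<alpha> j) (\<beta> j) (pair_degree m j) (m (Inl j)))"

lemma prod_little_qJacobi_eq:
  "(\<Prod>j\<in>UNIV. little_qJacobi q (\<alpha> j) (\<beta> j) (n j) (z $ Inl j) (z $ Inr j))
     = (\<Sum>m | pair_degree m = n. jacobi_multicoeff q \<alpha> \<beta> m * monomial z m)"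
proof -
  have "(\<Prod>j\<in>UNIV. little_qJacobi q (\<alpha> j) (\<beta> j) (n j) (z $ Inl j) (z $ Inr j))
      = (\<Sum>m | pair_degree m = n. \<Prod>j\<in>UNIV. jacobi_coeff q (\<alpha> j) (\<beta> j) (n j) (m (Inl j))
           * (z $ Inl j ^ m (Inl j) * z $ Inr j ^ m (Inr j)))"
    unfolding little_qJacobi_eq
    by (rule sum_pair_degree_fibre[where h = "\<lambda>j k l. jacobi_coeff q (\<alpha> j) (\<beta> j) (n j) k
          * (z $ Inl j ^ k * z $ Inr j ^ l)", symmetric])
  also have "\<dots> = (\<Sum>m | pair_degree m = n. jacobi_multicoeff q \<alpha> \<beta> m * monomial z m)"
    by (intro sum.cong) (auto simp: jacobi_multicoeff_def monomial_sum_index prod.distrib)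
  finally show ?thesis .
qed

section \<open>The equations as a recurrence, and its solutions\<close>

lemma qJacobi_equation_iff_coeffs:
  fixes f :: "complex ^ ('k::finite + 'k) \<Rightarrow> complex"
  assumes f: "has_power_series f a" and q: "norm q < 1"
  shows "(\<forall>\<^sub>F z in nhds 0.
            qderiv q (Inl j) (\<lambda>w. f w - \<alpha> * qshift q (Inl j) 1 f w) z
            = - q * qderiv q (Inr j)
                (\<lambda>w. qshift q (Inr j) (- 1) f w - q * \<alpha> * \<beta> * qshift q (Inl j) 2 f w) z)
     \<longleftrightarrow> (\<forall>m. (1 - q ^ Suc (m (Inl j)))
              * ((1 - \<alpha> * q ^ Suc (m (Inl j))) * a (m(Inl j := Suc (m (Inl j)))))
            = - q * ((1 - q ^ Suc (m (Inr j)))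
              * (((q powi (- 1)) ^ Suc (m (Inr j)) - q * \<alpha> * \<beta> * (q powi 2) ^ m (Inl j))
                * a (m(Inr j := Suc (m (Inr j)))))))"
proof -
  \<comment> \<open>The derivative is outermost, so a shift in the differentiated variable sees the
    raised exponent: \<open>Suc (m (Inl j))\<close> on the left, \<open>Suc (m (Inr j))\<close> on
    the right. The double shift in x_j under the y_j-derivative sees the unchanged
    \<open>m (Inl j)\<close>.\<close>
  note L = has_power_series_qderiv[OF has_power_series_diff[OF f
        has_power_series_cmult[OF has_power_series_qshift[OF f, of q "Inl j" 1], of \<alpha>]] q, of "Inl j"]
  note R = has_power_series_cmult[OF has_power_series_qderiv[OF has_power_series_diff[OF
        has_power_series_qshift[OF f, of q "Inr j" "- 1"]
        has_power_series_cmult[OF has_power_series_qshift[OF f, of q "Inl j" 2], of "q * \<alpha> * \<beta>"]]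
        q, of "Inr j"], of "- q"]
  show ?thesis
    unfolding has_power_series_eventually_eq_iff[OF L R]
    by (simp only: fun_upd_same fun_upd_other sum.distinct simp_thms power_int_1_right
          left_diff_distrib mult_1 mult.assoc)
qed

text \<open>The factors on the left never vanish, so within fixed pair degrees the recurrence
  determines every coefficient from that of the pure y-monomial; \<open>jacobi_multicoeff\<close> is
  one solution.\<close>

lemma jacobi_recurrence_iff:
  fixes a :: "('k::finite + 'k \<Rightarrow> nat) \<Rightarrow> complex"
  assumes q: "q \<noteq> 0" "norm q < 1" and \<alpha>: "\<And>j i. i \<ge> 1 \<Longrightarrow> \<alpha> j * q ^ i \<noteq> 1"
  shows "(\<forall>j m. (1 - q ^ Suc (m (Inl j)))
              * ((1 - \<alpha> j * q ^ Suc (m (Inl j))) * a (m(Inl j := Suc (m (Inl j)))))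
            = - q * ((1 - q ^ Suc (m (Inr j)))
              * (((q powi (- 1)) ^ Suc (m (Inr j)) - q * \<alpha> j * \<beta> j * (q powi 2) ^ m (Inl j))
                * a (m(Inr j := Suc (m (Inr j)))))))
     \<longleftrightarrow> (\<exists>c. \<forall>m. a m = c (pair_degree m) * jacobi_multicoeff q \<alpha> \<beta> m)"
    (is "(\<forall>j m. ?L a j m = ?R a j m) \<longleftrightarrow> ?closed")
proof -
  define B where "B = jacobi_multicoeff q \<alpha> \<beta>"
  note B_def' = B_def jacobi_multicoeff_def
  \<comment> \<open>Both coefficients in the recurrence have the same pair degrees, hence share the
    same constant.\<close>
  have deg_eq: "pair_degree (m(Inr j := Suc (m (Inr j)))) = pair_degree (m(Inl j := Suc (m (Inl j))))"
    for m :: "'k + 'k \<Rightarrow> nat" and j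
    by (auto simp: pair_degree_def fun_eq_iff)
  have B: "?L B j m = ?R B j m" for j m
  proof -
    define n where "n = pair_degree (m(Inl j := Suc (m (Inl j))))"
    have nj: "n j = Suc (m (Inl j) + m (Inr j))" by (simp add: n_def pair_degree_def)
    \<comment> \<open>The factors of the other pairs, which moving a unit within pair
      \<open>j\<close> leaves unchanged.\<close>
    define C where "C = (\<Prod>l\<in>UNIV - {j}. jacobi_coeff q (\<alpha> l) (\<beta> l) (n l) (m (Inl l)))"
    have "B (m(Inl j := Suc (m (Inl j)))) = jacobi_coeff q (\<alpha> j) (\<beta> j) (n j) (Suc (m (Inl j))) * C"
      unfolding B_def' n_def[symmetric] C_def by (subst prod.remove[of UNIV j]) auto
    moreover have "B (m(Inr j := Suc (m (Inr j)))) = jacobi_coeff q (\<alpha> j) (\<beta> j) (n j) (m (Inl j)) * C"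
      unfolding B_def' deg_eq n_def[symmetric] C_def by (subst prod.remove[of UNIV j]) auto
    moreover note jacobi_coeff_Suc[OF q \<alpha> nj, of j "\<beta> j", THEN arg_cong[where f = "\<lambda>x. x * C"]]
    ultimately show ?thesis by (simp only: mult.assoc mult_minus_left)
  qed
  show ?thesis
    unfolding B_def[symmetric]
  proof
    assume "\<exists>c. \<forall>m. a m = c (pair_degree m) * B m"
    then obtain c where c: "\<And>m. a m = c (pair_degree m) * B m" by blast
    show "\<forall>j m. ?L a j m = ?R a j m"
    proof (intro allI)
      fix j m
      from B[of m j, THEN arg_cong[where f = "\<lambda>x. c (pair_degree (m(Inl j := Suc (m (Inl j))))) * x"]]
      show "?L a j m = ?R a j m"
        unfolding c deg_eq by (simp only: mult.left_commute mult_minus_left mult_minus_right)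
    qed
  next
    assume rec: "\<forall>j m. ?L a j m = ?R a j m"
    \<comment> \<open>The constant is read off at the monomial free of all x_j, where
      \<open>B\<close> equals 1.\<close>
    define c where "c n = a (case_sum (\<lambda>_. 0) n)" for n
    have "a m = c (pair_degree m) * B m" for m
    proof (induction "\<Sum>j\<in>UNIV. m (Inl j)" arbitrary: m)
      case 0
      then have "m (Inl j) = 0" for j by simp
      then have "case_sum (\<lambda>_. 0) (pair_degree m) = m" and "B m = 1"
        by (auto simp: pair_degree_def fun_eq_iff B_def' q split: sum.split)
      then show ?case by (simp add: c_def)
    next
      case (Suc N)
      then obtain j where "m (Inl j) \<noteq> 0" by (metis nat.distinct(1) sum.neutral)
      \<comment> \<open>Removing one unit of x_j from \<open>m\<close> gives the base point of the
        recurrence; adding it to y_j instead gives \<open>m'\<close>, whose total x-degree is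
        smaller by one.\<close>
      define m\<^sub>1 where "m\<^sub>1 = m(Inl j := m (Inl j) - 1)"
      have m: "m = m\<^sub>1(Inl j := Suc (m\<^sub>1 (Inl j)))"
        using \<open>m (Inl j) \<noteq> 0\<close> by (auto simp: m\<^sub>1_def)
      define m' where "m' = m\<^sub>1(Inr j := Suc (m\<^sub>1 (Inr j)))"
      have "(\<Sum>l\<in>UNIV. m (Inl l)) = Suc (\<Sum>l\<in>UNIV. m' (Inl l))"
        unfolding m m'_def by (simp add: sum.remove[of UNIV j])
      then have IH: "a m' = c (pair_degree m) * B m'"
        using Suc(1)[of m'] Suc(2) deg_eq[of m\<^sub>1 j] by (simp add: m[symmetric] m'_def[symmetric])
      have "?L a j m\<^sub>1 = c (pair_degree m) * ?L B j m\<^sub>1"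
        unfolding rec[rule_format] B m'_def[symmetric] IH
        by (simp only: mult.left_commute mult_minus_left mult_minus_right)
      \<comment> \<open>These nonvanishing factors are cancelled to recover
        \<open>a m\<close>.\<close>
      moreover have "1 - q ^ Suc (m\<^sub>1 (Inl j)) \<noteq> 0" "1 - \<alpha> j * q ^ Suc (m\<^sub>1 (Inl j)) \<noteq> 0"
        using power_Suc_neq_1[OF q(2)] \<alpha>[of "Suc _" j] by (metis eq_iff_diff_eq_0, simp)
      ultimately show ?case
        unfolding m[symmetric] mult.left_commute[of "c _"] by (simp del: power_Suc)
    qed
    then show "\<exists>c. \<forall>m. a m = c (pair_degree m) * B m" by blast
  qed
qed

theorem theorem4p2:
  fixes q :: complex
    and \<alpha> \<beta> :: "'k::finite \<Rightarrow> complex"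
    and f :: "complex ^ ('k + 'k) \<Rightarrow> complex"
  assumes "0 < norm q" and "norm q < 1"
    and "\<And>j i. i \<ge> 1 \<Longrightarrow> \<alpha> j * q ^ i \<noteq> 1"
    and "analytic_at_point f 0"
  shows "(\<exists>c :: ('k \<Rightarrow> nat) \<Rightarrow> complex. \<forall>\<^sub>F z in nhds 0.
            ((\<lambda>n. c n * (\<Prod>j\<in>UNIV. little_qJacobi q (\<alpha> j) (\<beta> j) (n j) (z $ Inl j) (z $ Inr j)))
               has_sum f z) UNIV)
     \<longleftrightarrow> (\<forall>j. \<forall>\<^sub>F z in nhds 0.
            qderiv q (Inl j) (\<lambda>w. f w - \<alpha> j * qshift q (Inl j) 1 f w) z
            = - q * qderiv q (Inr j)
                (\<lambda>w. qshift q (Inr j) (- 1) f w - q * \<alpha> j * \<beta> j * qshift q (Inl j) 2 f w) z)"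
proof -
  obtain a where f: "has_power_series f a"
    using assms(4) analytic_at_point_0_iff by blast
  have "q \<noteq> 0" using assms(1) by auto
  \<comment> \<open>The expansion and the equations both become conditions on the coefficients
    \<open>a\<close>, which the recurrence lemma identifies.\<close>
  then show ?thesis
    unfolding qJacobi_equation_iff_coeffs[OF f assms(2)] prod_little_qJacobi_eq
      has_sum_homogeneous_iff[OF f]
    by (subst jacobi_recurrence_iff[OF _ assms(2,3)]) simp_all
qed

end
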